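(* Let $t\ge 3$ be an integer and let $G=(A\cup B,E)$ be a bipartite graph with bipartition $(A,B)$. Let $\mathcal{F}$ be the collection of all edge sets $F\subseteq E$ such that the subgraph $(A\cup B,F)$ has no $K_{1,t}$ with center vertex in $A$ (i.e. no vertex of $A$ has degree larger than $t-1$ in $(A\cup B,F)$). Then $M_t=(E,\mathcal{F})$ is a matroid with $\mathcal{F}$ as its family of independent sets.
   Context: Graphs are finite and simple. The center of $K_{1,t}$ is its vertex of degree $t$. *)

theory Defs
  imports Main
begin

text \<open>Finite simple graphs as pairs of a vertex set and a set of two-element edges.\<close>

type_synonym 'v graph = "'v set \<times> 'v set set"

abbreviation verts :: "'v graph \<Rightarrow> 'v set" where
  "verts G \<equiv> fst G"

abbreviation edges :: "'v graph \<Rightarrow> 'v set set" where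
  "edges G \<equiv> snd G"

definition simple_graph :: "'v graph \<Rightarrow> bool" where
  "simple_graph G \<longleftrightarrow> finite (verts G) \<and> (\<forall>e\<in>edges G. e \<subseteq> verts G \<and> card e = 2)"

definition subgraph :: "'v graph \<Rightarrow> 'v graph \<Rightarrow> bool" where
  "subgraph H G \<longleftrightarrow>
    simple_graph H \<and> simple_graph G \<and> verts H \<subseteq> verts G \<and> edges H \<subseteq> edges G"

definition degree :: "'v graph \<Rightarrow> 'v \<Rightarrow> nat" where
  "degree G v = card {e \<in> edges G. v \<in> e}"

definition bipartition :: "'v graph \<Rightarrow> 'v set \<Rightarrow> 'v set \<Rightarrow> bool" where
  "bipartition G X Y \<longleftrightarrow>
    X \<union> Y = verts G \<and> X \<inter> Y = {} \<and> (\<forall>e\<in>edges G. \<exists>x\<in>X. \<exists>y\<in>Y. e = {x, y})"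

definition complete_bipartite :: "nat \<Rightarrow> nat \<Rightarrow> 'v graph \<Rightarrow> bool" where
  "complete_bipartite m n H \<longleftrightarrow> simple_graph H \<and>
    (\<exists>X Y. bipartition H X Y \<and> card X = m \<and> card Y = n \<and>
      edges H = {{x, y} |x y. x \<in> X \<and> y \<in> Y})"

text \<open>The centre of a copy of \<open>K\<close> with parts of sizes \<open>1\<close> and \<open>t\<close> is its vertex of
  degree \<open>t\<close>; it is unique for \<open>t \<ge> 2\<close>.\<close>

definition star_with_center :: "nat \<Rightarrow> 'v graph \<Rightarrow> 'v \<Rightarrow> bool" where
  "star_with_center t H c \<longleftrightarrow> complete_bipartite 1 t H \<and> c \<in> verts H \<and> degree H c = t"

definition star_free_sets :: "nat \<Rightarrow> 'v set \<Rightarrow> 'v set \<Rightarrow> 'v set set \<Rightarrow> 'v set set set" where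
  "star_free_sets t A B E =
    {F. F \<subseteq> E \<and> \<not> (\<exists>H c. subgraph H (A \<union> B, F) \<and> star_with_center t H c \<and> c \<in> A)}"

locale matroid =
  fixes ground :: "'e set" and indep :: "'e set set"
  assumes finite_ground: "finite ground"
    and indep_subset_ground: "I \<in> indep \<Longrightarrow> I \<subseteq> ground"
    and empty_indep: "{} \<in> indep"
    and indep_subset: "I \<in> indep \<Longrightarrow> J \<subseteq> I \<Longrightarrow> J \<in> indep"
    and augmentation: "I \<in> indep \<Longrightarrow> J \<in> indep \<Longrightarrow> card I < card J \<Longrightarrow>
      \<exists>e \<in> J - I. insert e I \<in> indep"

end

theory Submission
  imports Defs
begin

text \<open>A vertex is the center of a copy of \<open>K\<^sub>1\<^sub>,\<^sub>t\<close> iff its degree is at least \<open>t\<close>. Each edge has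
  exactly one end in \<open>A\<close>, so the edges are partitioned by that end, and a set is independent iff it
  has at most \<open>t - 1\<close> edges in each class: \<open>M\<^sub>t\<close> is a partition matroid.\<close>

lemma finite_edges:
  assumes "simple_graph (V, E)"
  shows "finite E"
proof -
  have "E \<subseteq> Pow V" and "finite V"
    using assms by (auto simp: simple_graph_def)
  then show ?thesis
    by (meson finite_Pow_iff finite_subset)
qed

lemma simple_graph_edge_subset:
  assumes "simple_graph (V, E)" and "F \<subseteq> E"
  shows "simple_graph (V, F)"
  using assms by (auto simp: simple_graph_def)

text \<open>The vertex sets may differ because \<open>degree\<close> looks only at edges. This
  allows a star to be compared with the larger graph that contains it.\<close>

lemma degree_mono:
  assumes "finite E" and "F \<subseteq> E"
  shows "degree (W, F) a \<le> degree (V, E) a"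
  unfolding degree_def using assms by (auto intro!: card_mono)

lemma inj_on_doubleton: "inj_on (\<lambda>y. {a, y}) Y"
  by (auto simp: inj_on_def doubleton_eq_iff)

text \<open>An edge of a simple graph has two distinct ends, so an edge at \<open>a\<close> is
  determined by its other end. Counting edges at \<open>a\<close> thus becomes counting neighbours,
  which can serve as leaves of a star.\<close>

lemma incident_edges_eq_image:
  assumes "simple_graph (V, F)"
  shows "{e \<in> F. a \<in> e} = (\<lambda>y. {a, y}) ` {y \<in> V - {a}. {a, y} \<in> F}"
proof (intro equalityI subsetI)
  fix e
  assume e: "e \<in> {e \<in> F. a \<in> e}"
  then have "card e = 2" and "e \<subseteq> V"
    using assms by (auto simp: simple_graph_def)
  with e obtain y where "e = {a, y}" and "y \<noteq> a"
    by (auto simp: card_2_iff doubleton_eq_iff)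
  with e \<open>e \<subseteq> V\<close> show "e \<in> (\<lambda>y. {a, y}) ` {y \<in> V - {a}. {a, y} \<in> F}"
    by auto
qed auto

lemma star_graph_with_center:
  assumes "finite Y" and "a \<notin> Y"
  shows "star_with_center (card Y) (insert a Y, (\<lambda>y. {a, y}) ` Y) a"
proof -
  let ?S = "(\<lambda>y. {a, y}) ` Y"
  have simple: "simple_graph (insert a Y, ?S)"
    using assms by (auto simp: simple_graph_def card_2_iff)
  have "bipartition (insert a Y, ?S) {a} Y"
    using assms by (auto simp: bipartition_def)
  moreover have "?S = {{x, y} |x y. x \<in> {a} \<and> y \<in> Y}"
    by auto
  ultimately have "complete_bipartite 1 (card Y) (insert a Y, ?S)"
    unfolding complete_bipartite_def using simple
    by (intro conjI exI[of _ "{a}"] exI[of _ Y]) auto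
  moreover have "{e \<in> ?S. a \<in> e} = ?S"
    by auto
  ultimately show ?thesis
    by (simp add: star_with_center_def degree_def card_image inj_on_doubleton)
qed

text \<open>The \<open>t\<close> star edges at the center all lie in \<open>F\<close>; conversely,
  any \<open>t\<close> neighbours of \<open>a\<close> span a star with \<open>a\<close>. Subgraphs
  need not be induced, so further neighbours and edges between leaves do no harm.\<close>

lemma ex_star_subgraph_iff_degree:
  assumes "simple_graph (V, F)" and "a \<in> V"
  shows "(\<exists>H. subgraph H (V, F) \<and> star_with_center t H a) \<longleftrightarrow> t \<le> degree (V, F) a"
proof
  assume "\<exists>H. subgraph H (V, F) \<and> star_with_center t H a"
  then obtain W S where "S \<subseteq> F" and "degree (W, S) a = t"
    by (auto simp: subgraph_def star_with_center_def)
  then show "t \<le> degree (V, F) a"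
    using degree_mono finite_edges[OF assms(1)] by metis
next
  let ?N = "{y \<in> V - {a}. {a, y} \<in> F}"
  assume "t \<le> degree (V, F) a"
  also have "\<dots> = card ?N"
    using incident_edges_eq_image[OF assms(1), of a]
    by (simp add: degree_def card_image inj_on_doubleton)
  \<comment> \<open>The leaves: exactly \<open>t\<close> of the at least \<open>t\<close> neighbours
    of \<open>a\<close>.\<close>
  finally obtain Y where Y: "Y \<subseteq> ?N" "card Y = t" "finite Y"
    by (rule obtain_subset_with_card_n)
  let ?H = "(insert a Y, (\<lambda>y. {a, y}) ` Y)"
  have "star_with_center t ?H a"
    using star_graph_with_center[of Y a] Y by auto
  moreover from this have "subgraph ?H (V, F)"
    using assms Y by (auto simp: subgraph_def star_with_center_def complete_bipartite_def)
  ultimately show "\<exists>H. subgraph H (V, F) \<and> star_with_center t H a"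
    by blast
qed

lemma mem_star_free_sets_iff:
  assumes "t > 0" and "simple_graph (A \<union> B, E)"
  shows "F \<in> star_free_sets t A B E \<longleftrightarrow>
    F \<subseteq> E \<and> \<not> (\<exists>a\<in>A. degree (A \<union> B, F) a > t - 1)"
proof (cases "F \<subseteq> E")
  case True
  \<comment> \<open>Subtraction on naturals is truncated; \<open>t > 0\<close> makes
    \<open>t - 1 < d\<close> equivalent to \<open>t \<le> d\<close>.\<close>
  then have "(\<exists>H. subgraph H (A \<union> B, F) \<and> star_with_center t H a) \<longleftrightarrow>
      t - 1 < degree (A \<union> B, F) a" if "a \<in> A" for a
    using ex_star_subgraph_iff_degree[OF simple_graph_edge_subset[OF assms(2) True], of a t] that assms(1)
    by auto
  with True show ?thesis
    unfolding star_free_sets_def by blast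
qed (simp add: star_free_sets_def)

text \<open>The other end of the edge lies in \<open>B\<close>, which is disjoint from
  \<open>A\<close>. Hence edge classes belonging to different vertices of \<open>A\<close> are
  disjoint.\<close>

lemma bipartition_end_unique:
  assumes "bipartition (V, E) A B" and "e \<in> E" and "a \<in> A" "a \<in> e" and "a' \<in> A" "a' \<in> e"
  shows "a = a'"
  using assms by (fastforce simp: bipartition_def)

text \<open>Each edge is counted exactly once, at its only end in \<open>A\<close>.\<close>

lemma sum_degree_eq_card_edges:
  assumes "simple_graph (V, E)" and bip: "bipartition (V, E) A B"
  shows "(\<Sum>a\<in>A. degree (V, E) a) = card E"
proof -
  have "finite A"
    using assms by (auto simp: simple_graph_def bipartition_def intro: finite_subset)
  have "E = (\<Union>a\<in>A. {e \<in> E. a \<in> e})"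
    using bip by (fastforce simp: bipartition_def)
  also have "card \<dots> = (\<Sum>a\<in>A. card {e \<in> E. a \<in> e})"
    using \<open>finite A\<close> finite_edges[OF assms(1)] bipartition_end_unique[OF bip]
    by (intro card_UN_disjoint) auto
  finally show ?thesis
    by (simp add: degree_def)
qed

lemma bipartition_edge_subset:
  assumes "bipartition (V, E) A B" and "F \<subseteq> E"
  shows "bipartition (V, F) A B"
  using assms by (auto simp: bipartition_def)

lemma matroid_degree_bounded:
  assumes simple: "simple_graph (V, E)" and bip: "bipartition (V, E) A B"
  shows "matroid E {F. F \<subseteq> E \<and> (\<forall>a\<in>A. degree (V, F) a \<le> k)}"
proof
  show "finite E"
    using simple by (rule finite_edges)
next
  show "{} \<in> {F. F \<subseteq> E \<and> (\<forall>a\<in>A. degree (V, F) a \<le> k)}"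
    by (simp add: degree_def)
next
  fix I J
  assume "I \<in> {F. F \<subseteq> E \<and> (\<forall>a\<in>A. degree (V, F) a \<le> k)}" and "J \<subseteq> I"
  moreover from this have "degree (V, J) a \<le> degree (V, I) a" for a
    using finite_edges[OF simple] by (intro degree_mono) (auto intro: finite_subset)
  ultimately show "J \<in> {F. F \<subseteq> E \<and> (\<forall>a\<in>A. degree (V, F) a \<le> k)}"
    by (simp) (meson order_trans)
next
  fix I J
  assume "I \<in> {F. F \<subseteq> E \<and> (\<forall>a\<in>A. degree (V, F) a \<le> k)}"
    and "J \<in> {F. F \<subseteq> E \<and> (\<forall>a\<in>A. degree (V, F) a \<le> k)}"
    and less: "card I < card J"
  then have I: "I \<subseteq> E" "\<And>a. a \<in> A \<Longrightarrow> degree (V, I) a \<le> k"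
    and J: "J \<subseteq> E" "\<And>a. a \<in> A \<Longrightarrow> degree (V, J) a \<le> k"
    by auto
  have card_eq: "(\<Sum>a\<in>A. degree (V, F) a) = card F" if "F \<subseteq> E" for F
    using sum_degree_eq_card_edges simple_graph_edge_subset[OF simple that]
      bipartition_edge_subset[OF bip that] .
  \<comment> \<open>Both cardinalities split into degrees over \<open>A\<close>, so by pigeonhole
    some class contains more edges of \<open>J\<close> than of \<open>I\<close>.\<close>
  have "(\<Sum>a\<in>A. degree (V, I) a) < (\<Sum>a\<in>A. degree (V, J) a)"
    using less card_eq I(1) J(1) by simp
  then obtain a where a: "a \<in> A" "degree (V, I) a < degree (V, J) a"
    by (meson not_le sum_mono)
  have "finite I"
    using finite_edges[OF simple] I(1) by (rule finite_subset[rotated])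
  \<comment> \<open>The new edge is to come from the class of \<open>a\<close>. If \<open>I\<close>
    contained all edges of \<open>J\<close> at \<open>a\<close>, its degree there would be at least
    that of \<open>J\<close>.\<close>
  have "\<not> {e \<in> J. a \<in> e} \<subseteq> I"
  proof
    assume "{e \<in> J. a \<in> e} \<subseteq> I"
    then have "card {e \<in> J. a \<in> e} \<le> card {e \<in> I. a \<in> e}"
      using \<open>finite I\<close> by (intro card_mono) auto
    with a(2) show False
      by (simp add: degree_def)
  qed
  then obtain e where e: "e \<in> J" "a \<in> e" "e \<notin> I"
    by blast
  \<comment> \<open>Within \<open>A\<close>, adding \<open>e\<close> changes only the degree of
    \<open>a\<close>. That degree grows by one from a value strictly below the degree of
    \<open>a\<close> in \<open>J\<close>, which is at most \<open>k\<close>.\<close>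
  have "degree (V, insert e I) a' \<le> k" if "a' \<in> A" for a'
  proof (cases "a' = a")
    case True
    have "{x \<in> insert e I. a \<in> x} = insert e {x \<in> I. a \<in> x}"
      using e by auto
    then have "degree (V, insert e I) a = Suc (degree (V, I) a)"
      using e \<open>finite I\<close> by (simp add: degree_def)
    with a J(2)[OF a(1)] True show ?thesis
      by simp
  next
    case False
    then have "a' \<notin> e"
      using bipartition_end_unique[OF bip] e J(1) a(1) that by blast
    then have "{x \<in> insert e I. a' \<in> x} = {x \<in> I. a' \<in> x}"
      by auto
    with I(2)[OF that] show ?thesis
      by (simp add: degree_def)
  qed
  with e I(1) J(1) show "\<exists>e\<in>J - I. insert e I \<in> {F. F \<subseteq> E \<and> (\<forall>a\<in>A. degree (V, F) a \<le> k)}"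
    by blast
qed auto

theorem mainTheorem8:
  fixes t :: nat and A B :: "'v set" and E :: "'v set set"
  assumes "t \<ge> 3"
    and "simple_graph (A \<union> B, E)"
    and "bipartition (A \<union> B, E) A B"
  shows "(\<forall>F. F \<in> star_free_sets t A B E \<longleftrightarrow>
            F \<subseteq> E \<and> \<not> (\<exists>a\<in>A. degree (A \<union> B, F) a > t - 1)) \<and>
         matroid E (star_free_sets t A B E)"
proof -
  have mem: "F \<in> star_free_sets t A B E \<longleftrightarrow>
      F \<subseteq> E \<and> \<not> (\<exists>a\<in>A. degree (A \<union> B, F) a > t - 1)" for F
    using assms by (intro mem_star_free_sets_iff) auto
  then have "star_free_sets t A B E =
      {F. F \<subseteq> E \<and> (\<forall>a\<in>A. degree (A \<union> B, F) a \<le> t - 1)}"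
    by (auto simp: not_less)
  then have "matroid E (star_free_sets t A B E)"
    using matroid_degree_bounded[OF assms(2,3), of "t - 1"] by (simp only:)
  with mem show ?thesis
    by blast
qed

end
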